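(* Let $f,g:\mathbb{R}^n\to\mathbb{R}$ be $C^1$ functions and let $h:\mathbb{R}\to\mathbb{R}$ be differentiable. If $f(\mathbf{x})=h(g(\mathbf{x}))$ for all $\mathbf{x}\in\mathbb{R}^n$, then at every point $\mathbf{x}$ with $\nabla g(\mathbf{x})\neq 0$, $$h'\bigl(g(\mathbf{x})\bigr)=\frac{\nabla f(\mathbf{x})\cdot\nabla g(\mathbf{x})}{\|\nabla g(\mathbf{x})\|^2}.$$
   Context: Here $\nabla$ denotes the Euclidean gradient on $\mathbb{R}^n$, $\cdot$ the Euclidean inner product and $\|\cdot\|$ the Euclidean norm. *)

theory Defs
  imports "HOL-Analysis.Analysis"
begin

text \<open>The Euclidean gradient represents the Frechet derivative through the inner product.
  The value is unspecified at points where the function is not differentiable.\<close>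

definition grad :: "(real ^ 'n \<Rightarrow> real) \<Rightarrow> real ^ 'n \<Rightarrow> real ^ 'n" where
  "grad f x = (THE D. GDERIV f x :> D)"

text \<open>Frechet differentiability together with continuity of the gradient is the usual
  condition that all first partial derivatives exist and are continuous.\<close>

definition C1 :: "(real ^ 'n \<Rightarrow> real) \<Rightarrow> bool" where
  "C1 f \<longleftrightarrow> (\<forall>x. f differentiable (at x)) \<and> continuous_on UNIV (grad f)"

lemma grad_eqI:
  assumes "GDERIV f x :> D"
  shows "grad f x = D"
proof -
  have "D' = D" if "GDERIV f x :> D'" for D'
  proof -
    have "(\<lambda>h. inner h D') = (\<lambda>h. inner h D)"
      using assms that unfolding gderiv_def by (rule has_derivative_unique[rotated])
    then show ?thesis
      by (metis inner_commute vector_eq_rdot inner_eq_zero_iff)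
  qed
  with assms show ?thesis
    unfolding grad_def by (blast intro: the_equality)
qed

lemma differentiable_imp_GDERIV_grad:
  fixes f :: "real ^ 'n \<Rightarrow> real"
  assumes "f differentiable (at x)"
  shows "GDERIV f x :> grad f x"
proof -
  from assms obtain L where L: "(f has_derivative L) (at x)"
    unfolding differentiable_def by blast
  then have lin: "linear L"
    by (rule has_derivative_linear)
  have "L = (\<lambda>h. inner h (adjoint L 1))"
    using adjoint_works[OF lin, of _ 1] by (simp add: fun_eq_iff inner_commute)
  with L have "GDERIV f x :> adjoint L 1"
    unfolding gderiv_def by simp
  with grad_eqI[OF this] show ?thesis by simp
qed

end

theory Submission
  imports Defs
begin

text \<open>By the chain rule, \<open>\<nabla>(h \<circ> g)(x) = h'(g(x)) \<nabla>g(x)\<close>: the gradients of \<open>f = h \<circ> g\<close> and \<open>g\<close>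
  are parallel, with \<open>h'(g(x))\<close> as the factor of proportionality. Pairing both sides with
  \<open>\<nabla>g(x)\<close> turns this vector identity into a scalar one, which can be solved for \<open>h'(g(x))\<close>
  as soon as \<open>\<nabla>g(x) \<noteq> 0\<close>.\<close>

lemma grad_compose:
  fixes g :: "real ^ 'n \<Rightarrow> real" and h :: "real \<Rightarrow> real"
  assumes "g differentiable (at x)" and "h differentiable (at (g x))"
  shows "grad (\<lambda>y. h (g y)) x = deriv h (g x) *\<^sub>R grad g x"
proof (rule grad_eqI)
  have "DERIV h (g x) :> deriv h (g x)"
    using assms(2) by (simp add: DERIV_deriv_iff_real_differentiable)
  with differentiable_imp_GDERIV_grad[OF assms(1)]
  show "GDERIV (\<lambda>y. h (g y)) x :> deriv h (g x) *\<^sub>R grad g x"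
    by (rule GDERIV_DERIV_compose)
qed

theorem proposition1:
  fixes f g :: "real ^ 'n \<Rightarrow> real" and h :: "real \<Rightarrow> real"
  assumes "C1 f" and "C1 g"
    and "\<forall>t. h differentiable (at t)"
    and "\<forall>x. f x = h (g x)"
  shows "\<forall>x. grad g x \<noteq> 0 \<longrightarrow>
    deriv h (g x) = (grad f x \<bullet> grad g x) / (norm (grad g x))\<^sup>2"
proof (intro allI impI)
  fix x
  assume nz: "grad g x \<noteq> 0"
  have f_eq: "f = (\<lambda>y. h (g y))"
    using assms(4) by (simp add: fun_eq_iff)
  have "grad f x = deriv h (g x) *\<^sub>R grad g x"
    unfolding f_eq using assms(2,3) by (intro grad_compose) (auto simp: C1_def)
  then have "grad f x \<bullet> grad g x = deriv h (g x) * (norm (grad g x))\<^sup>2"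
    by (simp add: power2_norm_eq_inner)
  with nz show "deriv h (g x) = (grad f x \<bullet> grad g x) / (norm (grad g x))\<^sup>2"
    by simp
qed

end
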